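(* Let $(X,r)$ be a hypermultipermutational solution of the Yang--Baxter equation such that its left brace structure $G(X,r)$ is a Dedekind left brace whose additive group is not periodic. Then $(X,r)$ is a twist solution. In particular, if $X$ is a finite set and $(X,r)$ is a multipermutational solution such that $G(X,r)$ is a Dedekind left brace, then $(X,r)$ is a twist solution.
   Context: A left brace is a triple $(A,+,\cdot)$ such that $(A,+)$ is an abelian group, $(A,\cdot)$ is a group, and $a\cdot(b+c)=a\cdot b+a\cdot c-a$ for all $a,b,c\in A$. The two groups have the same identity $0$. Put $a\ast b=ab-a-b$ and $\lambda_a(b)=-a+ab$. A non-empty subset is a subbrace if it is a subgroup for both operations; a subbrace $I$ is an ideal of $A$ if $a\ast x, x\ast a\in I$ for all $a\in A$, $x\in I$. $A$ is Dedekind if every subbrace of $A$ is an ideal of $A$. A group is periodic if all its elements have finite order. A solution of the Yang--Baxter equation is a pair $(X,r)$ with $X$ a set and $r\colon X\times X\to X\times X$, $r(x,y)=(\lambda_x(y),\rho_y(x))$, such that: $r_{12}r_{23}r_{12}=r_{23}r_{12}r_{23}$ on $X^3$, where $r_{12}=r\times\mathrm{id}_X$ and $r_{23}=\mathrm{id}_X\times r$; $r^2=\mathrm{id}_{X\times X}$ (involutive); all maps $\lambda_x,\rho_x\colon X\to X$ are bijective (non-degenerate). A twist solution is one with $r(x,y)=(y,x)$ for all $x,y\in X$. The retraction $\operatorname{Ret}(X,r)=(X/\!\sim,\overline r)$ is defined by $x\sim y$ iff $\lambda_x=\lambda_y$ and $\rho_x=\rho_y$, with $\overline r([x],[y])=([\lambda_x(y)],[\rho_y(x)])$.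 Set $\operatorname{Ret}^0(X,r)=(X,r)$, $\operatorname{Ret}^{\alpha+1}(X,r)=\operatorname{Ret}(\operatorname{Ret}^\alpha(X,r))$ for every ordinal $\alpha$, and for a limit ordinal $\lambda$ let $\operatorname{Ret}^\lambda(X,r)$ be the solution induced on $X/\!\sim_\lambda$, where $\sim_\lambda=\bigcup_{\mu<\lambda}\sim_\mu$ and $\sim_\mu$ denotes the equivalence relation on $X$ of having the same image in $\operatorname{Ret}^\mu(X,r)$. $\operatorname{Ret}^\infty(X,r)$ is the term at which this series stabilises. $(X,r)$ is hypermultipermutational if $\operatorname{Ret}^\infty(X,r)$ has cardinality $1$, and multipermutational (of level $m$) if $m$ is the smallest non-negative integer such that $\operatorname{Ret}^m(X,r)$ has cardinality $1$. The structure group of $(X,r)$ is the group $G(X,r)$ with generators the elements of $X$ and relations $xy=\lambda_x(y)\rho_y(x)$ for all $x,y\in X$. The canonical map $\iota\colon X\to G(X,r)$ is injective. The left brace structure of $(X,r)$ is the standard left brace with multiplicative group $G(X,r)$, whose additive group is free abelian with basis $\iota(X)$ and for which $\lambda_{\iota(x)}(\iota(y))=\iota(\lambda_x(y))$ for all $x,y\in X$. *)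

theory Defs
  imports "HOL-Algebra.Ring" "HOL-Algebra.Free_Abelian_Groups"
begin

section \<open>Left braces\<close>

text \<open>
  The record of rings serves as the signature of a brace: the additive group is
  \<^term>\<open>add_monoid A\<close> and the (not necessarily commutative) multiplicative group is \<open>A\<close> itself.
\<close>

locale left_brace = abelian_group A + group A for A (structure) +
  assumes brace_distrib:
    "\<lbrakk>a \<in> carrier A; b \<in> carrier A; c \<in> carrier A\<rbrakk>
      \<Longrightarrow> a \<otimes> (b \<oplus> c) = (a \<otimes> b \<oplus> a \<otimes> c) \<ominus> a"

lemma (in left_brace) one_eq_zero: "\<one> = \<zero>"
proof -
  have "\<one> \<otimes> (\<zero> \<oplus> \<zero>) = (\<one> \<otimes> \<zero> \<oplus> \<one> \<otimes> \<zero>) \<ominus> \<one>"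
    by (rule brace_distrib) auto
  then have "\<zero> = \<ominus> \<one>"
    by (simp add: minus_eq)
  then have "\<ominus> \<zero> = \<ominus> (\<ominus> \<one>)"
    by (rule arg_cong)
  then show ?thesis
    using l_neg[OF zero_closed] r_zero[OF a_inv_closed[OF zero_closed]] by simp
qed

definition brace_star :: "('a, 'b) ring_scheme \<Rightarrow> 'a \<Rightarrow> 'a \<Rightarrow> 'a" where
  "brace_star A a b = (a \<otimes>\<^bsub>A\<^esub> b \<ominus>\<^bsub>A\<^esub> a) \<ominus>\<^bsub>A\<^esub> b"

definition brace_lambda :: "('a, 'b) ring_scheme \<Rightarrow> 'a \<Rightarrow> 'a \<Rightarrow> 'a" where
  "brace_lambda A a b = \<ominus>\<^bsub>A\<^esub> a \<oplus>\<^bsub>A\<^esub> a \<otimes>\<^bsub>A\<^esub> b"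

definition subbrace :: "'a set \<Rightarrow> ('a, 'b) ring_scheme \<Rightarrow> bool" where
  "subbrace I A \<longleftrightarrow> subgroup I (add_monoid A) \<and> subgroup I A"

definition brace_ideal :: "'a set \<Rightarrow> ('a, 'b) ring_scheme \<Rightarrow> bool" where
  "brace_ideal I A \<longleftrightarrow> subbrace I A \<and>
     (\<forall>a\<in>carrier A. \<forall>x\<in>I. brace_star A a x \<in> I \<and> brace_star A x a \<in> I)"

definition dedekind_brace :: "('a, 'b) ring_scheme \<Rightarrow> bool" where
  "dedekind_brace A \<longleftrightarrow> left_brace A \<and> (\<forall>I. subbrace I A \<longrightarrow> brace_ideal I A)"

definition periodic_group :: "('a, 'b) monoid_scheme \<Rightarrow> bool" where
  "periodic_group G \<longleftrightarrow> (\<forall>x\<in>carrier G. \<exists>n::nat. n > 0 \<and> x [^]\<^bsub>G\<^esub> n = \<one>\<^bsub>G\<^esub>)"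


section \<open>Solutions of the Yang--Baxter equation\<close>

text \<open>
  \<open>lam r x y\<close> is $\lambda_x(y)$ and \<open>rho r y x\<close> is $\rho_y(x)$, so that
  \<open>r (x, y) = (lam r x y, rho r y x)\<close>.
\<close>

definition lam :: "('a \<times> 'a \<Rightarrow> 'a \<times> 'a) \<Rightarrow> 'a \<Rightarrow> 'a \<Rightarrow> 'a" where
  "lam r x y = fst (r (x, y))"

definition rho :: "('a \<times> 'a \<Rightarrow> 'a \<times> 'a) \<Rightarrow> 'a \<Rightarrow> 'a \<Rightarrow> 'a" where
  "rho r y x = snd (r (x, y))"

definition r12 :: "('a \<times> 'a \<Rightarrow> 'a \<times> 'a) \<Rightarrow> 'a \<times> 'a \<times> 'a \<Rightarrow> 'a \<times> 'a \<times> 'a" where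
  "r12 r = (\<lambda>(x, y, z). (fst (r (x, y)), snd (r (x, y)), z))"

definition r23 :: "('a \<times> 'a \<Rightarrow> 'a \<times> 'a) \<Rightarrow> 'a \<times> 'a \<times> 'a \<Rightarrow> 'a \<times> 'a \<times> 'a" where
  "r23 r = (\<lambda>(x, y, z). (x, r (y, z)))"

definition ybe_solution :: "'a set \<Rightarrow> ('a \<times> 'a \<Rightarrow> 'a \<times> 'a) \<Rightarrow> bool" where
  "ybe_solution X r \<longleftrightarrow>
     r \<in> X \<times> X \<rightarrow> X \<times> X \<and>
     (\<forall>t \<in> X \<times> X \<times> X. r12 r (r23 r (r12 r t)) = r23 r (r12 r (r23 r t))) \<and>
     (\<forall>p \<in> X \<times> X. r (r p) = p) \<and>
     (\<forall>x\<in>X. bij_betw (lam r x) X X \<and> bij_betw (rho r x) X X)"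

definition twist_solution :: "'a set \<Rightarrow> ('a \<times> 'a \<Rightarrow> 'a \<times> 'a) \<Rightarrow> bool" where
  "twist_solution X r \<longleftrightarrow> (\<forall>x\<in>X. \<forall>y\<in>X. r (x, y) = (y, x))"


section \<open>Iterated retractions\<close>

definition ret_equiv :: "'a set \<Rightarrow> ('a \<times> 'a \<Rightarrow> 'a \<times> 'a) \<Rightarrow> 'a rel" where
  "ret_equiv X r = {(x, y) \<in> X \<times> X.
     (\<forall>z\<in>X. lam r x z = lam r y z) \<and> (\<forall>z\<in>X. rho r x z = rho r y z)}"

text \<open>
  The map induced on \<^term>\<open>X // E\<close>; the unions do not depend on representatives when \<open>E\<close> is
  compatible with \<open>r\<close>.
\<close>

definition quot_map :: "'a rel \<Rightarrow> ('a \<times> 'a \<Rightarrow> 'a \<times> 'a) \<Rightarrow> 'a set \<times> 'a set \<Rightarrow> 'a set \<times> 'a set" where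
  "quot_map E r = (\<lambda>(P, Q). (\<Union>x\<in>P. \<Union>y\<in>Q. E `` {lam r x y}, \<Union>x\<in>P. \<Union>y\<in>Q. E `` {rho r y x}))"

text \<open>
  Forming the quotient repeatedly would change the type at every step. Each term of the retraction
  series is therefore represented by the equivalence relation \<open>E\<close> on \<open>X\<close> of having the same image
  in it, the term itself being the solution \<^term>\<open>(X // E, quot_map E r)\<close>. Two elements of \<open>X\<close>
  have the same image in the next term iff their \<open>E\<close>-classes are identified by the retraction of
  that solution.
\<close>

definition ret_step :: "'a set \<Rightarrow> ('a \<times> 'a \<Rightarrow> 'a \<times> 'a) \<Rightarrow> 'a rel \<Rightarrow> 'a rel" where
  "ret_step X r E = {(x, y) \<in> X \<times> X.
     (E `` {x}, E `` {y}) \<in> ret_equiv (X // E) (quot_map E r)}"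

text \<open>
  Ordinals are elements of a well-order \<open>W\<close>. As \<open>\<sim>\<^sub>\<alpha>\<close> is determined by the initial segment
  of \<open>W\<close> below \<open>\<alpha>\<close>, it does not depend on the choice of a long enough \<open>W\<close>.
\<close>

definition ret_series :: "'o rel \<Rightarrow> 'a set \<Rightarrow> ('a \<times> 'a \<Rightarrow> 'a \<times> 'a) \<Rightarrow> 'o \<Rightarrow> 'a rel" where
  "ret_series W X r =
     wo_rel.worecZSL W (Id_on X) (\<lambda>_. ret_step X r) (\<lambda>R \<alpha>. \<Union>\<beta>\<in>underS W \<alpha>. R \<beta>)"

lemma ret_series_adm:
  assumes "Well_order W"
  shows "wo_rel.adm_woL W (\<lambda>R \<alpha>. \<Union>\<beta>\<in>underS W \<alpha>. R \<beta>)"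
  unfolding wo_rel.adm_woL_def[OF wo_rel.intro[OF assms]] by (metis (no_types, lifting) SUP_cong)

lemma ret_series_zero:
  assumes "Well_order W"
  shows "ret_series W X r (wo_rel.zero W) = Id_on X"
  unfolding ret_series_def using assms
  by (intro wo_rel.worecZSL_zero ret_series_adm) (auto simp: wo_rel_def)

lemma ret_series_succ:
  assumes "Well_order W" "aboveS W \<alpha> \<noteq> {}"
  shows "ret_series W X r (wo_rel.succ W \<alpha>) = ret_step X r (ret_series W X r \<alpha>)"
  unfolding ret_series_def using assms
  by (intro wo_rel.worecZSL_succ ret_series_adm) (auto simp: wo_rel_def)

lemma ret_series_lim:
  assumes "Well_order W" "wo_rel.isLim W \<alpha>" "\<alpha> \<noteq> wo_rel.zero W"
  shows "ret_series W X r \<alpha> = (\<Union>\<beta>\<in>underS W \<alpha>. ret_series W X r \<beta>)"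
  unfolding ret_series_def using assms
  by (intro wo_rel.worecZSL_isLim ret_series_adm) (auto simp: wo_rel_def)

text \<open>The initial ordinal of the successor cardinal of $\max(\aleph_0, |X|)$.\<close>

definition ret_ordinals :: "'a set \<Rightarrow> (nat + 'a) set rel" where
  "ret_ordinals X = cardSuc (natLeq +c |X| )"

definition ret_stable :: "'a set \<Rightarrow> ('a \<times> 'a \<Rightarrow> 'a \<times> 'a) \<Rightarrow> (nat + 'a) set \<Rightarrow> bool" where
  "ret_stable X r \<alpha> \<longleftrightarrow>
     \<alpha> \<in> Field (ret_ordinals X) \<and>
     ret_series (ret_ordinals X) X r (wo_rel.succ (ret_ordinals X) \<alpha>) =
       ret_series (ret_ordinals X) X r \<alpha>"

definition ret_infinity :: "'a set \<Rightarrow> ('a \<times> 'a \<Rightarrow> 'a \<times> 'a) \<Rightarrow> 'a rel" where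
  "ret_infinity X r =
     ret_series (ret_ordinals X) X r (wo_rel.minim (ret_ordinals X) {\<alpha>. ret_stable X r \<alpha>})"

definition hypermultipermutational :: "'a set \<Rightarrow> ('a \<times> 'a \<Rightarrow> 'a \<times> 'a) \<Rightarrow> bool" where
  "hypermultipermutational X r \<longleftrightarrow> card (X // ret_infinity X r) = 1"

definition multipermutational_of_level :: "'a set \<Rightarrow> ('a \<times> 'a \<Rightarrow> 'a \<times> 'a) \<Rightarrow> nat \<Rightarrow> bool" where
  "multipermutational_of_level X r m \<longleftrightarrow>
     card (X // ret_series natLeq X r m) = 1 \<and>
     (\<forall>k<m. card (X // ret_series natLeq X r k) \<noteq> 1)"

definition multipermutational :: "'a set \<Rightarrow> ('a \<times> 'a \<Rightarrow> 'a \<times> 'a) \<Rightarrow> bool" where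
  "multipermutational X r \<longleftrightarrow> (\<exists>m. multipermutational_of_level X r m)"


subsection \<open>Stabilisation of the series\<close>

lemma ret_step_equiv: "equiv X (ret_step X r E)"
  by (rule equivI)
     (auto simp: ret_step_def ret_equiv_def refl_on_def sym_def trans_def intro: quotientI)

lemma ret_step_increasing:
  assumes "equiv X E"
  shows "E \<subseteq> ret_step X r E"
proof clarify
  fix x y assume xy: "(x, y) \<in> E"
  then have "x \<in> X" "y \<in> X" "E `` {x} = E `` {y}"
    using assms equiv_class_eq[OF assms xy] by (auto simp: equiv_def)
  then show "(x, y) \<in> ret_step X r E"
    by (auto simp: ret_step_def ret_equiv_def intro: quotientI)
qed

lemma ret_series_equiv_mono:
  assumes W: "Well_order W" and "\<alpha> \<in> Field W"
  shows "equiv X (ret_series W X r \<alpha>) \<and>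
         (\<forall>\<beta>\<in>underS W \<alpha>. ret_series W X r \<beta> \<subseteq> ret_series W X r \<alpha>)"
proof -
  interpret wo_rel W by (simp add: wo_rel_def W)
  let ?R = "ret_series W X r"
  have "\<alpha> \<in> Field W \<longrightarrow> equiv X (?R \<alpha>) \<and> (\<forall>\<beta>\<in>underS \<alpha>. ?R \<beta> \<subseteq> ?R \<alpha>)"
  proof (induction \<alpha> rule: well_order_inductZSL)
    case Zero
    then show ?case
      by (auto simp: ret_series_zero[OF W] intro!: equivI refl_onI symI transI)
  next
    case (Suc \<alpha>)
    have "\<alpha> \<in> Field W"
      using Suc(1) by (auto simp: aboveS_def Field_def)
    then have IH: "equiv X (?R \<alpha>)" "\<And>\<beta>. \<beta> \<in> underS \<alpha> \<Longrightarrow> ?R \<beta> \<subseteq> ?R \<alpha>"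
      using Suc by auto
    have *: "?R \<alpha> \<subseteq> ?R (succ \<alpha>)"
      using Suc IH by (simp add: ret_series_succ[OF W] ret_step_increasing)
    have "?R \<beta> \<subseteq> ?R (succ \<alpha>)" if "\<beta> \<in> underS (succ \<alpha>)" for \<beta>
    proof (cases "\<beta> = \<alpha>")
      case False
      then have "\<beta> \<in> underS \<alpha>"
        using that Suc(1) by (auto simp: underS_def under_def)
      then show ?thesis using IH * by blast
    qed (use * in simp)
    then show ?case
      using Suc by (simp add: ret_series_succ[OF W] ret_step_equiv)
  next
    case (Lim \<alpha>)
    have lim: "?R \<alpha> = (\<Union>\<beta>\<in>underS \<alpha>. ?R \<beta>)"
      using Lim by (intro ret_series_lim[OF W]) auto
    show ?case
    proof (intro impI conjI)
      assume \<alpha>: "\<alpha> \<in> Field W"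
      have IH: "equiv X (?R \<beta>)" "\<And>\<gamma>. \<gamma> \<in> underS \<beta> \<Longrightarrow> ?R \<gamma> \<subseteq> ?R \<beta>"
        if "\<beta> \<in> underS \<alpha>" for \<beta>
        using Lim(3)[OF that] that by (auto simp: underS_def Field_def)
      have zero: "zero \<in> underS \<alpha>"
        using Lim zero_smallest[OF \<alpha>] by (auto simp: underS_def)
      show "equiv X (?R \<alpha>)"
      proof (rule equivI)
        show "?R \<alpha> \<subseteq> X \<times> X"
          using IH unfolding lim equiv_def by blast
        show "refl_on X (?R \<alpha>)"
          using zero ret_series_zero[OF W, of X r] unfolding lim refl_on_def by blast
        show "sym (?R \<alpha>)"
          using IH unfolding lim equiv_def sym_def by blast
        show "trans (?R \<alpha>)"
        proof (rule transI)
          fix x y z assume "(x, y) \<in> ?R \<alpha>" "(y, z) \<in> ?R \<alpha>"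
          then obtain \<beta> \<gamma> where
            b: "\<beta> \<in> underS \<alpha>" "(x, y) \<in> ?R \<beta>" and g: "\<gamma> \<in> underS \<alpha>" "(y, z) \<in> ?R \<gamma>"
            unfolding lim by blast
          have "\<beta> = \<gamma> \<or> \<beta> \<in> underS \<gamma> \<or> \<gamma> \<in> underS \<beta>"
            using b(1) g(1) TOTALS by (auto simp: underS_def Field_def)
          then obtain \<delta> where "\<delta> \<in> underS \<alpha>" "(x, y) \<in> ?R \<delta>" "(y, z) \<in> ?R \<delta>"
            using b g IH(2) by blast
          then show "(x, z) \<in> ?R \<alpha>"
            using IH(1) unfolding lim equiv_def trans_def by blast
        qed
      qed
      show "\<forall>\<beta>\<in>underS \<alpha>. ?R \<beta> \<subseteq> ?R \<alpha>"
        unfolding lim by blast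
    qed
  qed
  then show ?thesis using assms by blast
qed

lemma ret_ordinals_Card_order: "Card_order (ret_ordinals X)"
  unfolding ret_ordinals_def by (intro cardSuc_Card_order Card_order_csum)

lemma ret_ordinals_Well_order: "Well_order (ret_ordinals X)"
  using ret_ordinals_Card_order by (rule card_order_on_well_order_on)

lemma ret_ordinals_aboveS:
  assumes "\<alpha> \<in> Field (ret_ordinals X)"
  shows "aboveS (ret_ordinals X) \<alpha> \<noteq> {}"
proof -
  have "Cinfinite (natLeq +c |X| )"
    by (intro Cinfinite_csum1 natLeq_Cinfinite)
  then have "infinite (Field (ret_ordinals X))"
    unfolding ret_ordinals_def using cardSuc_finite[of "natLeq +c |X|"] by (auto simp: cinfinite_def)
  then show ?thesis
    using infinite_Card_order_limit[OF ret_ordinals_Card_order _ assms]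
    by (auto simp: aboveS_def)
qed

theorem ret_series_stabilises: "\<exists>\<alpha>. ret_stable X r \<alpha>"
proof (rule ccontr)
  assume unstable: "\<nexists>\<alpha>. ret_stable X r \<alpha>"
  let ?W = "ret_ordinals X" and ?R = "ret_series (ret_ordinals X) X r"
  interpret wo_rel ?W by (simp add: wo_rel_def ret_ordinals_Well_order)
  note W = ret_ordinals_Well_order[of X]
  have succ: "succ \<alpha> \<in> Field ?W" "\<alpha> \<in> underS (succ \<alpha>)" if "\<alpha> \<in> Field ?W" for \<alpha>
    using succ_in_diff[OF ret_ordinals_aboveS[OF that]] FieldI2 underS_I by metis+
  have "\<exists>p. p \<in> ?R (succ \<alpha>) - ?R \<alpha>" if "\<alpha> \<in> Field ?W" for \<alpha>
  proof -
    have "?R \<alpha> \<subseteq> ?R (succ \<alpha>)"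
      using ret_series_equiv_mono[OF W succ(1)[OF that]] succ(2)[OF that] by blast
    moreover have "?R (succ \<alpha>) \<noteq> ?R \<alpha>"
      using unstable that by (auto simp: ret_stable_def)
    ultimately show ?thesis by blast
  qed
  then obtain p where p: "\<And>\<alpha>. \<alpha> \<in> Field ?W \<Longrightarrow> p \<alpha> \<in> ?R (succ \<alpha>) - ?R \<alpha>"
    by metis
  have "inj_on p (Field ?W)"
  proof (rule inj_on_Field[OF subset_refl])
    fix \<alpha> \<beta> assume ab: "\<alpha> \<in> Field ?W" "\<beta> \<in> Field ?W" "\<alpha> \<in> underS \<beta>"
    have "(succ \<alpha>, \<beta>) \<in> ?W"
      using ab(3) by (intro succ_smallest) (auto simp: underS_def)
    then have "?R (succ \<alpha>) \<subseteq> ?R \<beta>"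
      using ret_series_equiv_mono[OF W ab(2), of X r] by (cases "succ \<alpha> = \<beta>") (auto simp: underS_def)
    then show "p \<alpha> \<noteq> p \<beta>"
      using p[OF ab(1)] p[OF ab(2)] by auto
  qed
  moreover have "p ` Field ?W \<subseteq> X \<times> X"
  proof -
    have "?R (succ \<alpha>) \<subseteq> X \<times> X" if "\<alpha> \<in> Field ?W" for \<alpha>
      using ret_series_equiv_mono[OF W succ(1)[OF that], of X r] by (auto simp: equiv_def)
    then show ?thesis using p by blast
  qed
  ultimately have "|Field ?W| \<le>o |X \<times> X|"
    using card_of_ordLeq by blast
  then have "?W \<le>o |X \<times> X|"
    using card_of_Field_ordIso[OF ret_ordinals_Card_order] ordIso_symmetric ordIso_ordLeq_trans
    by blast
  also have "|X \<times> X| \<le>o natLeq +c |X|"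
  proof (cases "finite X")
    case True
    then have "|X \<times> X| \<le>o natLeq"
      by (intro ordLess_imp_ordLeq) (simp add: finite_iff_ordLess_natLeq[symmetric])
    also have "natLeq \<le>o natLeq +c |X|"
      by (intro ordLeq_csum1 natLeq_Card_order)
    finally show ?thesis .
  next
    case False
    then have "|X \<times> X| =o |X|"
      by (rule card_of_Times_same_infinite)
    also have "|X| \<le>o natLeq +c |X|"
      by (intro ordLeq_csum2 card_of_Card_order)
    finally show ?thesis .
  qed
  finally have "cardSuc (natLeq +c |X| ) \<le>o natLeq +c |X|"
    by (simp add: ret_ordinals_def)
  then show False
    using cardSuc_greater[OF Card_order_csum] not_ordLess_ordLeq by blast
qed

lemma ret_series_natLeq: "ret_series natLeq X r n = (ret_step X r ^^ n) (Id_on X)"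
proof -
  interpret wo_rel natLeq by (simp add: wo_rel_def natLeq_Well_order)
  have le: "(i, j) \<in> natLeq \<longleftrightarrow> i \<le> j" for i j :: nat
    by (simp add: natLeq_def)
  have zero: "zero = 0"
    using zero_smallest[of "0::nat"] le by (simp add: Field_natLeq)
  have above: "aboveS k \<noteq> {}" for k
    by (auto simp: aboveS_def le intro!: exI[of _ "Suc k"])
  have succ: "succ k = Suc k" for k
    using succ_smallest[of k "Suc k"] succ_in_diff[OF above, of k] le by fastforce
  show ?thesis
    by (induction n)
       (use ret_series_zero[OF natLeq_Well_order, of X r]
            ret_series_succ[OF natLeq_Well_order above, of X r] zero succ in auto)
qed


section \<open>Groups given by generators and relators\<close>

text \<open>
  Words are lists of letters \<^term>\<open>(True, x)\<close>, standing for $x$, and \<^term>\<open>(False, x)\<close>, standing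
  for $x^{-1}$.
\<close>

definition words :: "'a set \<Rightarrow> (bool \<times> 'a) list set" where
  "words X = lists (UNIV \<times> X)"

inductive_set word_cong ::
    "'a set \<Rightarrow> ((bool \<times> 'a) list \<times> (bool \<times> 'a) list) set \<Rightarrow> (bool \<times> 'a) list rel"
  for X Rel where
  refl: "w \<in> words X \<Longrightarrow> (w, w) \<in> word_cong X Rel"
| sym: "(u, v) \<in> word_cong X Rel \<Longrightarrow> (v, u) \<in> word_cong X Rel"
| trans: "(u, v) \<in> word_cong X Rel \<Longrightarrow> (v, w) \<in> word_cong X Rel \<Longrightarrow> (u, w) \<in> word_cong X Rel"
| cancel: "u \<in> words X \<Longrightarrow> v \<in> words X \<Longrightarrow> x \<in> X
    \<Longrightarrow> (u @ [(b, x), (\<not> b, x)] @ v, u @ v) \<in> word_cong X Rel"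
| relation: "u \<in> words X \<Longrightarrow> v \<in> words X \<Longrightarrow> p \<in> words X \<Longrightarrow> q \<in> words X \<Longrightarrow> (p, q) \<in> Rel
    \<Longrightarrow> (u @ p @ v, u @ q @ v) \<in> word_cong X Rel"

definition presented_group ::
    "'a set \<Rightarrow> ((bool \<times> 'a) list \<times> (bool \<times> 'a) list) set \<Rightarrow> (bool \<times> 'a) list set monoid" where
  "presented_group X Rel =
     \<lparr>carrier = words X // word_cong X Rel,
      mult = (\<lambda>P Q. \<Union>u\<in>P. \<Union>v\<in>Q. word_cong X Rel `` {u @ v}),
      one = word_cong X Rel `` {[]}\<rparr>"

lemma word_cong_words: "(u, v) \<in> word_cong X Rel \<Longrightarrow> u \<in> words X \<and> v \<in> words X"
  by (induction rule: word_cong.induct) (auto simp: words_def)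

lemma word_cong_equiv: "equiv (words X) (word_cong X Rel)"
proof (rule equivI)
  show "word_cong X Rel \<subseteq> words X \<times> words X"
    using word_cong_words by fast
  show "refl_on (words X) (word_cong X Rel)"
    by (rule refl_onI) (rule word_cong.refl)
  show "sym (word_cong X Rel)"
    by (rule symI) (rule word_cong.sym)
  show "trans (word_cong X Rel)"
    by (rule transI) (rule word_cong.trans)
qed

lemma word_cong_context:
  assumes "(u, v) \<in> word_cong X Rel" "a \<in> words X" "b \<in> words X"
  shows "(a @ u @ b, a @ v @ b) \<in> word_cong X Rel"
  using assms
proof (induction rule: word_cong.induct)
  case (refl w)
  then show ?case
    by (intro word_cong.refl) (simp add: words_def)
next
  case (sym u v)
  then show ?case
    by (blast intro: word_cong.sym)
next
  case (trans u v w)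
  then show ?case
    by (meson word_cong.trans)
next
  case (cancel u v x c)
  then show ?case
    using word_cong.cancel[of "a @ u" X "v @ b" x c Rel] by (simp add: words_def)
next
  case (relation u v p q)
  then show ?case
    using word_cong.relation[of "a @ u" X "v @ b" p q Rel] by (simp add: words_def)
qed

lemma word_cong_append:
  assumes "(u, u') \<in> word_cong X Rel" "(v, v') \<in> word_cong X Rel"
  shows "(u @ v, u' @ v') \<in> word_cong X Rel"
proof (rule word_cong.trans)
  have "[] \<in> words X"
    by (simp add: words_def)
  then show "(u @ v, u' @ v) \<in> word_cong X Rel" "(u' @ v, u' @ v') \<in> word_cong X Rel"
    using word_cong_context[OF assms(1), of "[]" v] word_cong_context[OF assms(2), of u' "[]"]
      word_cong_words[OF assms(1)] word_cong_words[OF assms(2)] by simp_all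
qed

lemma presented_group_mult:
  assumes "u \<in> words X" "v \<in> words X"
  shows "word_cong X Rel `` {u} \<otimes>\<^bsub>presented_group X Rel\<^esub> word_cong X Rel `` {v} =
         word_cong X Rel `` {u @ v}"
proof -
  have "word_cong X Rel `` {u' @ v'} = word_cong X Rel `` {u @ v}"
    if "(u, u') \<in> word_cong X Rel" "(v, v') \<in> word_cong X Rel" for u' v'
    using equiv_class_eq[OF word_cong_equiv word_cong_append[OF that]] by simp
  moreover have "(u, u) \<in> word_cong X Rel" "(v, v) \<in> word_cong X Rel"
    using assms by (auto intro: word_cong.refl)
  ultimately show ?thesis
    unfolding presented_group_def monoid.simps by blast
qed

lemma group_presented_group: "group (presented_group X Rel)"
proof (rule groupI)
  let ?G = "presented_group X Rel" and ?c = "\<lambda>w. word_cong X Rel `` {w}"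
  have app: "u @ v \<in> words X" if "u \<in> words X" "v \<in> words X" for u v
    using that by (auto simp: words_def)
  have rep: "\<exists>w\<in>words X. P = ?c w" if "P \<in> carrier ?G" for P
    using that by (auto simp: presented_group_def elim: quotientE)
  have carr: "?c w \<in> carrier ?G" if "w \<in> words X" for w
    using that by (auto simp: presented_group_def intro: quotientI)
  have Nil: "[] \<in> words X"
    by (simp add: words_def)
  have one: "\<one>\<^bsub>?G\<^esub> = ?c []"
    by (simp add: presented_group_def)
  show "\<one>\<^bsub>?G\<^esub> \<in> carrier ?G"
    using carr[OF Nil] one by simp
  show "P \<otimes>\<^bsub>?G\<^esub> Q \<in> carrier ?G" if "P \<in> carrier ?G" "Q \<in> carrier ?G" for P Q
    using rep[OF that(1)] rep[OF that(2)] carr app by (metis presented_group_mult)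
  show "P \<otimes>\<^bsub>?G\<^esub> Q \<otimes>\<^bsub>?G\<^esub> S = P \<otimes>\<^bsub>?G\<^esub> (Q \<otimes>\<^bsub>?G\<^esub> S)"
    if "P \<in> carrier ?G" "Q \<in> carrier ?G" "S \<in> carrier ?G" for P Q S
    using rep[OF that(1)] rep[OF that(2)] rep[OF that(3)]
    by (elim bexE) (simp add: presented_group_mult app)
  show "\<one>\<^bsub>?G\<^esub> \<otimes>\<^bsub>?G\<^esub> P = P" if "P \<in> carrier ?G" for P
    using rep[OF that] by (elim bexE) (simp add: presented_group_mult one Nil)
  have "\<exists>v\<in>words X. (v @ u, []) \<in> word_cong X Rel" if "u \<in> words X" for u
    using that
  proof (induction u)
    case Nil
    show ?case
      using word_cong.refl[of "[]" X Rel] by (auto simp: words_def)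
  next
    case (Cons l u)
    obtain b x where l: "l = (b, x)" "x \<in> X" and u: "u \<in> words X"
      using Cons.prems by (cases l) (auto simp: words_def)
    obtain v where v: "v \<in> words X" "(v @ u, []) \<in> word_cong X Rel"
      using Cons.IH[OF u] by blast
    have "(v @ [(\<not> b, x), l] @ u, v @ u) \<in> word_cong X Rel"
      using word_cong.cancel[OF v(1) u l(2), of "\<not> b" Rel] l by simp
    then have "((v @ [(\<not> b, x)]) @ l # u, []) \<in> word_cong X Rel"
      using word_cong.trans[OF _ v(2)] by simp
    moreover have "v @ [(\<not> b, x)] \<in> words X"
      using v(1) l(2) by (auto simp: words_def)
    ultimately show ?case by blast
  qed
  then show "\<exists>Q\<in>carrier ?G. Q \<otimes>\<^bsub>?G\<^esub> P = \<one>\<^bsub>?G\<^esub>" if "P \<in> carrier ?G" for P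
    using rep[OF that] by (metis carr equiv_class_eq[OF word_cong_equiv] one presented_group_mult)
qed


section \<open>The structure group and the left brace structure of a solution\<close>

definition structure_relations ::
    "'a set \<Rightarrow> ('a \<times> 'a \<Rightarrow> 'a \<times> 'a) \<Rightarrow> ((bool \<times> 'a) list \<times> (bool \<times> 'a) list) set" where
  "structure_relations X r =
     {([(True, x), (True, y)], [(True, lam r x y), (True, rho r y x)]) | x y. x \<in> X \<and> y \<in> X}"

definition structure_group ::
    "'a set \<Rightarrow> ('a \<times> 'a \<Rightarrow> 'a \<times> 'a) \<Rightarrow> (bool \<times> 'a) list set monoid" where
  "structure_group X r = presented_group X (structure_relations X r)"

definition structure_map ::
    "'a set \<Rightarrow> ('a \<times> 'a \<Rightarrow> 'a \<times> 'a) \<Rightarrow> 'a \<Rightarrow> (bool \<times> 'a) list set" where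
  "structure_map X r x = word_cong X (structure_relations X r) `` {[(True, x)]}"

text \<open>
  The conditions below determine the operations of \<open>A\<close> on its carrier: \<open>\<lambda>\<close> is a homomorphism
  from the multiplicative group to the automorphisms of the additive group, hence determined by
  its values on generators, and $a + b = a \lambda_a^{-1}(b)$.
\<close>

definition is_structure_brace ::
    "'a set \<Rightarrow> ('a \<times> 'a \<Rightarrow> 'a \<times> 'a) \<Rightarrow> (bool \<times> 'a) list set ring \<Rightarrow> bool" where
  "is_structure_brace X r A \<longleftrightarrow>
     left_brace A \<and>
     carrier A = carrier (structure_group X r) \<and>
     (\<forall>a\<in>carrier A. \<forall>b\<in>carrier A. a \<otimes>\<^bsub>A\<^esub> b = a \<otimes>\<^bsub>structure_group X r\<^esub> b) \<and>
     (\<exists>h \<in> iso (free_Abelian_group X) (add_monoid A). \<forall>x\<in>X. h (frag_of x) = structure_map X r x) \<and>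
     (\<forall>x\<in>X. \<forall>y\<in>X. brace_lambda A (structure_map X r x) (structure_map X r y) =
                     structure_map X r (lam r x y))"

end

theory Submission
  imports Defs
begin

text \<open>
  The multiplicative group of the structure brace $A$ permutes the basis \<open>X\<close> of its additive group
  through \<open>\<lambda>\<close>, and \<open>(X, r)\<close> is a twist solution iff every orbit of this action is a singleton.
  So let \<open>Y\<close> be an orbit with at least two elements.

  The Dedekind property enters through two families of subbraces. The additive span of \<open>Y\<close> is a
  subbrace, since it is \<open>\<lambda>\<close>-invariant; as an ideal it contains $x * w = \lambda_x(w) - w$ for
  $x \in Y$, which forces $\lambda_x(w) = w$ for every basis element $w \notin Y$ (lemma
  \<open>orbit_acts_trivially_outside\<close>). On the socle, the kernel of \<open>\<lambda>\<close>, the two operations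
  coincide, so the multiples of a socle element \<open>s\<close> form a subbrace; as an ideal it contains
  every $\lambda_a(s)$ (lemma \<open>socle_action_multiple\<close>).

  These facts imply that different elements of \<open>Y\<close> act differently. If $x \neq y$ in \<open>Y\<close>
  act equally, then $x - y$ lies in the socle, each $\lambda_a(x - y)$ is a multiple of $x - y$, and
  therefore $Y = \{x, y\}$. Either $\lambda_x$ fixes \<open>Y\<close> pointwise; then $x$ itself lies in
  the socle and has a trivial orbit. Or $\lambda_x$ interchanges $x$ and $y$; then $2x = x \cdot y$
  lies in the socle while $\lambda_x(2x) = 2y$ is not a multiple of $2x$. Both are absurd.
  Nor does any $x \in Y$ act on \<open>Y\<close> like a basis element outside \<open>Y\<close>: the latter fixes \<open>Y\<close>
  pointwise, so again $x$ would lie in the socle (theorem \<open>orbit_separates\<close>).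

  Finally, an invariant set \<open>Y\<close> whose elements are told apart from all others by their action on
  \<open>Y\<close> survives every retraction: by transfinite induction, the class of each of its elements is a
  singleton at every stage (lemma \<open>ret_series_class_singleton\<close>). This is impossible if some
  stage identifies all of \<open>X\<close>.
\<close>

section \<open>The action of the multiplicative group on the additive group\<close>

context left_brace
begin

abbreviation brace_action (\<open>\<Lambda>\<close>) where "\<Lambda> \<equiv> brace_lambda A"

lemma action_closed [simp]:
  assumes "a \<in> carrier A" "b \<in> carrier A"
  shows "\<Lambda> a b \<in> carrier A"
  using assms by (simp add: brace_lambda_def)

lemma mult_eq_add_action:
  assumes "a \<in> carrier A" "b \<in> carrier A"
  shows "a \<otimes> b = a \<oplus> \<Lambda> a b"
  using assms by (simp add: brace_lambda_def a_assoc[symmetric] r_neg)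

lemma brace_star_eq:
  assumes "a \<in> carrier A" "b \<in> carrier A"
  shows "brace_star A a b = \<Lambda> a b \<ominus> b"
  using assms by (simp add: brace_star_def brace_lambda_def minus_eq a_ac)

lemma action_add:
  assumes "a \<in> carrier A" "b \<in> carrier A" "c \<in> carrier A"
  shows "\<Lambda> a (b \<oplus> c) = \<Lambda> a b \<oplus> \<Lambda> a c"
  using assms by (simp add: brace_lambda_def brace_distrib minus_eq a_ac)

lemma action_zero [simp]:
  assumes "a \<in> carrier A"
  shows "\<Lambda> a \<zero> = \<zero>"
  using mult_eq_add_action[OF assms zero_closed] r_one[OF assms] assms
  by (simp add: one_eq_zero)

lemma action_neg:
  assumes "a \<in> carrier A" "b \<in> carrier A"
  shows "\<Lambda> a (\<ominus> b) = \<ominus> \<Lambda> a b"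
proof -
  have "\<Lambda> a (\<ominus> b) \<oplus> \<Lambda> a b = \<zero>"
    using assms by (simp flip: action_add add: l_neg)
  then show ?thesis
    using assms by (simp add: minus_equality)
qed

lemma action_mult:
  assumes "a \<in> carrier A" "b \<in> carrier A" "c \<in> carrier A"
  shows "\<Lambda> (a \<otimes> b) c = \<Lambda> a (\<Lambda> b c)"
proof -
  have "a \<otimes> b \<oplus> \<Lambda> (a \<otimes> b) c = a \<otimes> (b \<otimes> c)"
    using assms by (simp flip: mult_eq_add_action add: m_assoc)
  also have "\<dots> = a \<oplus> \<Lambda> a (b \<oplus> \<Lambda> b c)"
    using assms by (simp add: mult_eq_add_action)
  also have "\<dots> = a \<otimes> b \<oplus> \<Lambda> a (\<Lambda> b c)"
    using assms by (simp add: action_add mult_eq_add_action a_assoc)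
  finally show ?thesis
    using assms by simp
qed

lemma action_one [simp]:
  assumes "a \<in> carrier A"
  shows "\<Lambda> \<one> a = a"
  using assms by (simp add: brace_lambda_def) (simp add: one_eq_zero)

lemma action_inv_cancel [simp]:
  assumes "a \<in> carrier A" "b \<in> carrier A"
  shows "\<Lambda> (inv a) (\<Lambda> a b) = b" "\<Lambda> a (\<Lambda> (inv a) b) = b"
  using assms by (simp_all flip: action_mult)

text \<open>
  With \<open>mult_eq_add_action\<close> this expresses both multiplicative operations by additive ones and
  \<open>\<lambda>\<close>, which is why \<open>\<lambda>\<close>-invariant additive subgroups are subbraces.
\<close>

lemma inv_eq_neg_action:
  assumes "a \<in> carrier A"
  shows "inv a = \<ominus> \<Lambda> (inv a) a"
proof -
  have "inv a \<oplus> \<Lambda> (inv a) a = \<zero>"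
    using assms by (simp flip: mult_eq_add_action one_eq_zero)
  then show ?thesis
    using assms by (simp add: minus_equality)
qed

lemma subbraceI:
  assumes S: "subgroup S (add_monoid A)"
    and inv_S: "\<And>a b. \<lbrakk>a \<in> S; b \<in> S\<rbrakk> \<Longrightarrow> \<Lambda> a b \<in> S \<and> \<Lambda> (inv a) b \<in> S"
  shows "subbrace S A"
  unfolding subbrace_def
proof
  have sub: "S \<subseteq> carrier A"
    using subgroup.subset[OF S] by simp
  have add: "a \<oplus> b \<in> S" if "a \<in> S" "b \<in> S" for a b
    using subgroup.m_closed[OF S that] by simp
  have neg: "\<ominus> a \<in> S" if "a \<in> S" for a
    using subgroup.m_inv_closed[OF S that] by (simp add: a_inv_def)
  show "subgroup S A"
  proof (rule subgroupI)
    show "S \<noteq> {}" using subgroup.one_closed[OF S] by blast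
    show "inv a \<in> S" if "a \<in> S" for a
      by (subst inv_eq_neg_action) (use neg inv_S that sub in auto)
    show "a \<otimes> b \<in> S" if "a \<in> S" "b \<in> S" for a b
      using that sub add inv_S[OF that] by (simp add: mult_eq_add_action subset_iff)
  qed (rule sub)
qed (rule S)

text \<open>The additive group is abelian, so the usual socle of a left brace reduces to the kernel of \<open>\<lambda>\<close>.\<close>

definition "socle = {s \<in> carrier A. \<forall>b\<in>carrier A. \<Lambda> s b = b}"

text \<open>Multiplication and addition, and the two kinds of inverses, coincide on the socle.\<close>

lemma socle_subgroup: "subgroup socle (add_monoid A)"
proof (rule add.subgroupI)
  show "socle \<subseteq> carrier A"
    by (auto simp: socle_def)
  have "\<zero> \<in> socle"
    using action_one by (simp add: socle_def one_eq_zero)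
  then show "socle \<noteq> {}" by blast
  fix s t assume s: "s \<in> socle" and t: "t \<in> socle"
  have inv: "\<Lambda> (inv s) b = b" if "b \<in> carrier A" for b
    using s that action_inv_cancel(1)[of s b] by (simp add: socle_def)
  have "inv s = \<ominus> \<Lambda> (inv s) s"
    using s by (intro inv_eq_neg_action) (simp add: socle_def)
  also have "\<Lambda> (inv s) s = s"
    using s by (intro inv) (simp add: socle_def)
  finally have "inv s = \<ominus> s" .
  then show "\<ominus> s \<in> socle"
    using s inv by (simp add: socle_def)
  have "s \<otimes> t = s \<oplus> t"
    using s t by (simp add: mult_eq_add_action socle_def)
  then show "s \<oplus> t \<in> socle"
    using s t action_mult[of s t] by (simp add: socle_def)
qed

lemma socle_subbrace:
  assumes "subgroup S (add_monoid A)" "S \<subseteq> socle"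
  shows "subbrace S A"
proof (rule subbraceI[OF assms(1)])
  fix a b assume "a \<in> S" "b \<in> S"
  then show "\<Lambda> a b \<in> S \<and> \<Lambda> (inv a) b \<in> S"
    using assms(2) action_inv_cancel(1)[of a b] by (auto simp: socle_def subset_iff)
qed

text \<open>For an additive subgroup, absorbing $a * s = \lambda_a(s) - s$ means being \<open>\<lambda>\<close>-invariant.\<close>

lemma ideal_action_closed:
  assumes "brace_ideal S A" "a \<in> carrier A" "s \<in> S"
  shows "\<Lambda> a s \<in> S"
proof -
  have S: "subgroup S (add_monoid A)" and s: "s \<in> carrier A"
    using assms(1,3) subgroup.mem_carrier by (fastforce simp: brace_ideal_def subbrace_def)+
  have "brace_star A a s \<in> S"
    using assms by (auto simp: brace_ideal_def)
  then have "brace_star A a s \<oplus> s \<in> S"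
    using subgroup.m_closed[OF S _ assms(3)] by simp
  then show ?thesis
    using assms(2) s by (simp add: brace_star_eq minus_eq a_assoc l_neg)
qed

lemma generate_subgroup:
  "S \<subseteq> carrier A \<Longrightarrow> subgroup (generate (add_monoid A) S) (add_monoid A)"
  by (rule group.generate_is_subgroup[OF a_group]) simp

end

section \<open>Braces acting by permutations of an additive basis\<close>

text \<open>
  The basis is given as the image of the standard basis of a free abelian group under an isomorphism;
  the inverse isomorphism then supplies coefficients.
\<close>

locale permuted_basis_brace = left_brace A for A (structure) +
  fixes X :: "'x set" and h :: "('x \<Rightarrow>\<^sub>0 int) \<Rightarrow> 'a"
  assumes h_iso: "h \<in> iso (free_Abelian_group X) (add_monoid A)"
    and action_permutes:
      "\<lbrakk>a \<in> carrier A; x \<in> X\<rbrakk> \<Longrightarrow> \<exists>y\<in>X. brace_lambda A a (h (frag_of x)) = h (frag_of y)"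
begin

abbreviation basis :: "'x \<Rightarrow> 'a" where
  "basis x \<equiv> h (frag_of x)"

definition coeff :: "'a \<Rightarrow> 'x \<Rightarrow> int" where
  "coeff a = Poly_Mapping.lookup (inv_into (carrier (free_Abelian_group X)) h a)"

lemma basis_closed [simp]: "x \<in> X \<Longrightarrow> basis x \<in> carrier A"
  using h_iso by (auto simp: iso_def hom_def Pi_iff)

lemma coeff_basis [simp]:
  assumes "x \<in> X"
  shows "coeff (basis x) y = (if y = x then 1 else 0)"
proof -
  have "inj_on h (carrier (free_Abelian_group X))"
    using h_iso by (auto simp: iso_def bij_betw_def)
  then show ?thesis
    using assms by (simp add: coeff_def inv_into_f_f del: carrier_free_Abelian_group_iff)
qed

lemma basis_inj: "\<lbrakk>x \<in> X; y \<in> X; basis x = basis y\<rbrakk> \<Longrightarrow> x = y"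
  using coeff_basis[of x x] coeff_basis[of y x] by (simp split: if_splits)

lemma coeff_hom:
  "inv_into (carrier (free_Abelian_group X)) h \<in> hom (add_monoid A) (free_Abelian_group X)"
  using group.iso_set_sym[OF _ h_iso] by (simp add: iso_def)

lemma coeff_add [simp]:
  "\<lbrakk>a \<in> carrier A; b \<in> carrier A\<rbrakk> \<Longrightarrow> coeff (a \<oplus> b) x = coeff a x + coeff b x"
  using hom_mult[OF coeff_hom] by (simp add: coeff_def lookup_add)

lemma coeff_zero [simp]: "coeff \<zero> x = 0"
  using coeff_add[of \<zero> \<zero> x] by simp

lemma coeff_neg [simp]: "a \<in> carrier A \<Longrightarrow> coeff (\<ominus> a) x = - coeff a x"
  using coeff_add[of a "\<ominus> a" x] by (simp add: r_neg)

lemma basis_induct [consumes 1, case_names zero basis diff]: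
  assumes "a \<in> carrier A"
    and "P \<zero>" "\<And>x. x \<in> X \<Longrightarrow> P (basis x)"
    and diff: "\<And>a b. \<lbrakk>a \<in> carrier A; b \<in> carrier A; P a; P b\<rbrakk> \<Longrightarrow> P (a \<ominus> b)"
  shows "P a"
proof -
  let ?F = "free_Abelian_group X"
  interpret h: group_hom ?F "add_monoid A" h
  proof (intro group_hom.intro group_hom_axioms.intro)
    show "h \<in> hom ?F (add_monoid A)"
      using h_iso unfolding iso_def by blast
  qed (rule group_free_Abelian_group a_group)+
  obtain f where f: "f \<in> carrier ?F" "a = h f"
  proof -
    have "h ` carrier ?F = carrier A"
      using h_iso by (simp add: iso_def bij_betw_def)
    then show thesis using assms(1) that by blast
  qed
  have "P (h f)"
  proof (rule free_Abelian_group_induct[where S = X and P = "\<lambda>f. P (h f)"])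
    show "Poly_Mapping.keys f \<subseteq> X" using f(1) by simp
    show "P (h 0)" using h.hom_one assms(2) by simp
    fix f g assume fg: "Poly_Mapping.keys f \<subseteq> X" "Poly_Mapping.keys g \<subseteq> X" "P (h f)" "P (h g)"
    have "h (f - g) = h f \<ominus> h g"
      using fg h.hom_mult[of f "- g"] h.hom_inv[of g] by (simp add: minus_eq a_inv_def)
    then show "P (h (f - g))"
      using fg h.hom_closed[of f] h.hom_closed[of g] diff by simp
  qed (rule assms(3))
  then show ?thesis using f by simp
qed

lemma action_eqI:
  assumes "a \<in> carrier A" "b \<in> carrier A" "c \<in> carrier A"
    and basis: "\<And>x. x \<in> X \<Longrightarrow> \<Lambda> a (basis x) = \<Lambda> b (basis x)"
  shows "\<Lambda> a c = \<Lambda> b c"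
  using assms(3)
proof (induction rule: basis_induct)
  case (diff c d)
  then show ?case
    using assms(1,2) by (simp add: minus_eq action_add action_neg)
qed (use assms in simp_all)

lemma socleI:
  assumes "a \<in> carrier A" "\<And>x. x \<in> X \<Longrightarrow> \<Lambda> a (basis x) = basis x"
  shows "a \<in> socle"
  using action_eqI[OF assms(1) one_closed] assms by (simp add: socle_def)

definition orbit :: "'x \<Rightarrow> 'x set" where
  "orbit z = {y \<in> X. \<exists>a\<in>carrier A. \<Lambda> a (basis z) = basis y}"

lemma orbit_subset: "orbit z \<subseteq> X"
  by (auto simp: orbit_def)

lemma orbit_refl: "z \<in> X \<Longrightarrow> z \<in> orbit z"
  using one_closed by (auto simp: orbit_def intro!: bexI[of _ \<one>])

lemma orbit_trans:
  assumes "z \<in> X" "y \<in> orbit z" "w \<in> orbit y"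
  shows "w \<in> orbit z"
proof -
  obtain a b where "a \<in> carrier A" "\<Lambda> a (basis z) = basis y"
    "b \<in> carrier A" "\<Lambda> b (basis y) = basis w"
    using assms by (auto simp: orbit_def)
  then show ?thesis
    using assms by (auto simp: orbit_def action_mult intro!: bexI[of _ "b \<otimes> a"])
qed

lemma orbit_sym:
  assumes "z \<in> X" "y \<in> orbit z"
  shows "z \<in> orbit y"
proof -
  obtain a where "a \<in> carrier A" "\<Lambda> a (basis z) = basis y"
    using assms by (auto simp: orbit_def)
  then have "inv a \<in> carrier A" "\<Lambda> (inv a) (basis y) = basis z"
    using action_inv_cancel(1)[of a "basis z"] assms by auto
  then show ?thesis
    using assms by (auto simp: orbit_def)
qed

lemma orbit_eq:
  assumes "z \<in> X" "y \<in> orbit z"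
  shows "orbit y = orbit z"
  using assms orbit_trans orbit_sym orbit_subset by blast

lemma orbit_action:
  assumes "a \<in> carrier A" "z \<in> X" "y \<in> orbit z"
  obtains w where "w \<in> orbit z" "\<Lambda> a (basis y) = basis w"
proof -
  obtain w where w: "w \<in> X" "\<Lambda> a (basis y) = basis w"
    using action_permutes assms orbit_subset by blast
  then have "w \<in> orbit y"
    using assms(1) by (auto simp: orbit_def)
  then show thesis
    using w that orbit_eq[OF assms(2,3)] by simp
qed

definition span :: "'x set \<Rightarrow> 'a set" where
  "span Y = generate (add_monoid A) (basis ` Y)"

lemma span_subgroup: "Y \<subseteq> X \<Longrightarrow> subgroup (span Y) (add_monoid A)"
  unfolding span_def by (intro generate_subgroup) auto

lemma span_closed: "\<lbrakk>Y \<subseteq> X; a \<in> span Y\<rbrakk> \<Longrightarrow> a \<in> carrier A"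
  using subgroup.subset[OF span_subgroup] by auto

lemma coeff_span:
  assumes "Y \<subseteq> X" "a \<in> span Y" "w \<notin> Y"
  shows "coeff a w = 0"
  using assms(2) unfolding span_def
proof (induction rule: generate.induct)
  case (inv a)
  then obtain y where "a = basis y" "y \<in> Y" by blast
  then show ?case
    using assms by (auto simp flip: a_inv_def)
next
  case (eng a b)
  then show ?case
    using span_closed[OF assms(1)] by (simp add: span_def)
qed (use assms in auto)

text \<open>The action is additive and carries the basis elements of an orbit to each other.\<close>

lemma span_action:
  assumes "z \<in> X" "a \<in> carrier A" "b \<in> span (orbit z)"
  shows "\<Lambda> a b \<in> span (orbit z)"
  using assms(3) unfolding span_def
proof (induction rule: generate.induct)
  case one
  then show ?case
    using assms generate.one[of "add_monoid A"] by simp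
next
  case (incl b)
  then obtain y where "b = basis y" "y \<in> orbit z" by blast
  then show ?case
    using orbit_action[OF assms(2,1)] by (metis generate.incl imageI)
next
  case (inv b)
  then obtain y where y: "b = basis y" "y \<in> orbit z" by blast
  then obtain w where w: "w \<in> orbit z" "\<Lambda> a b = basis w"
    using orbit_action[OF assms(2,1)] by metis
  have "b \<in> carrier A" using y orbit_subset by (blast intro: basis_closed)
  then have "\<Lambda> a (inv\<^bsub>add_monoid A\<^esub> b) = inv\<^bsub>add_monoid A\<^esub> basis w"
    using w assms(2) action_neg by (simp flip: a_inv_def)
  then show ?case
    using w(1) by (auto intro: generate.inv)
next
  case (eng b c)
  have "b \<in> carrier A" "c \<in> carrier A"
    using eng span_closed[OF orbit_subset] by (auto simp: span_def)
  then show ?case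
    using eng assms(2) generate.eng[OF eng(3,4)] by (simp add: action_add)
qed

section \<open>Orbits in Dedekind braces with a permuted basis\<close>

context
  assumes dedekind: "dedekind_brace A"
begin

text \<open>
  The span \<open>S\<close> of the orbit is an ideal, so $x * w = \lambda_x(w) - w$ lies in \<open>S\<close>. But
  $\lambda_x(w)$ is again a basis element, and if it were different from \<open>w\<close>, the coefficient of
  this difference at \<open>w\<close> would be \<open>-1\<close>, whereas elements of \<open>S\<close> have coefficient \<open>0\<close> there.
\<close>

lemma orbit_acts_trivially_outside:
  assumes "z \<in> X" "x \<in> orbit z" "w \<in> X" "w \<notin> orbit z"
  shows "\<Lambda> (basis x) (basis w) = basis w"
proof -
  let ?S = "span (orbit z)"
  have x: "basis x \<in> carrier A" "basis x \<in> ?S"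
    using assms(2) orbit_subset by (auto simp: span_def intro: generate.incl basis_closed)
  have "subbrace ?S A"
    using span_action[OF assms(1)] span_closed[OF orbit_subset]
    by (intro subbraceI span_subgroup orbit_subset) auto
  then have "brace_star A (basis x) (basis w) \<in> ?S"
    using dedekind x assms by (auto simp: dedekind_brace_def brace_ideal_def)
  then have star: "coeff (\<Lambda> (basis x) (basis w) \<ominus> basis w) w = 0"
    using coeff_span[OF orbit_subset _ assms(4)] x assms(3) by (simp add: brace_star_eq)
  obtain v where v: "v \<in> X" "\<Lambda> (basis x) (basis w) = basis v"
    using action_permutes[OF x(1) assms(3)] by blast
  then have "v = w"
    using star assms(3) by (simp add: minus_eq split: if_splits)
  then show ?thesis using v by simp
qed

text \<open>The multiples of \<open>s\<close> form a subbrace inside the socle, hence an ideal.\<close>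

lemma socle_action_multiple:
  assumes "s \<in> socle" "a \<in> carrier A"
  obtains k where "\<And>x. coeff (\<Lambda> a s) x = k * coeff s x"
proof -
  let ?S = "generate (add_monoid A) {s}"
  have s: "s \<in> carrier A"
    using assms(1) by (simp add: socle_def)
  have S: "subgroup ?S (add_monoid A)"
    using s by (intro generate_subgroup) simp
  have "?S \<subseteq> socle"
    using group.generate_subgroup_incl[OF a_group _ socle_subgroup] assms(1) by simp
  then have "brace_ideal ?S A"
    using dedekind socle_subbrace[OF S] by (simp add: dedekind_brace_def)
  then have "\<Lambda> a s \<in> ?S"
    using assms(2) by (rule ideal_action_closed) (simp add: generate.incl)
  moreover have "\<exists>k. \<forall>x. coeff t x = k * coeff s x" if "t \<in> ?S" for t
    using that
  proof (induction rule: generate.induct)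
    case one
    show ?case by (rule exI[of _ 0]) simp
  next
    case (incl t)
    then show ?case by (intro exI[of _ 1]) simp
  next
    case (inv t)
    then show ?case using s by (intro exI[of _ "-1"]) (simp flip: a_inv_def)
  next
    case (eng t u)
    have "t \<in> carrier A" "u \<in> carrier A"
      using eng subgroup.subset[OF S] by auto
    moreover obtain k l where "\<forall>x. coeff t x = k * coeff s x" "\<forall>x. coeff u x = l * coeff s x"
      using eng by blast
    ultimately show ?case
      by (intro exI[of _ "k + l"]) (simp add: algebra_simps)
  qed
  ultimately show thesis using that by blast
qed

text \<open>A basis element is a multiple of another one only if they are equal.\<close>

lemma orbit_of_socle_element:
  assumes "x \<in> X" "basis x \<in> socle"
  shows "orbit x = {x}"
proof -
  have "y = x" if y: "y \<in> orbit x" for y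
  proof -
    obtain a where a: "y \<in> X" "a \<in> carrier A" "\<Lambda> a (basis x) = basis y"
      using y by (auto simp: orbit_def)
    obtain k where "\<And>w. coeff (\<Lambda> a (basis x)) w = k * coeff (basis x) w"
      using socle_action_multiple[OF assms(2) a(2)] by blast
    from this[of y] show ?thesis
      using a assms(1) by (simp split: if_splits)
  qed
  then show ?thesis using orbit_refl[OF assms(1)] by blast
qed

text \<open>
  The quotient $t = x y^{-1}$ acts trivially, and $x = t \cdot y = t + y$, so the difference
  $x - y$ is in the socle. For every $a$ the difference of the basis elements $\lambda_a(x)$ and
  $\lambda_a(y)$ is thus a multiple of $x - y$, which leaves only \<open>x\<close> and \<open>y\<close> as values
  of $\lambda_a(x)$.
\<close>

lemma orbit_of_equally_acting:
  assumes "x \<in> X" "y \<in> X" "x \<noteq> y"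
    and same: "\<And>w. w \<in> X \<Longrightarrow> \<Lambda> (basis x) (basis w) = \<Lambda> (basis y) (basis w)"
  shows "orbit x \<subseteq> {x, y}"
proof
  let ?t = "basis x \<otimes> inv basis y"
  have xy: "basis x \<in> carrier A" "basis y \<in> carrier A"
    using assms by auto
  have "\<Lambda> ?t b = b" if "b \<in> carrier A" for b
    using action_eqI[OF xy, of "\<Lambda> (inv basis y) b"] same xy that by (simp add: action_mult)
  then have t: "?t \<in> socle"
    using xy by (simp add: socle_def)
  have "?t \<oplus> basis y = ?t \<otimes> basis y"
    using t xy by (simp add: mult_eq_add_action socle_def)
  also have "\<dots> = basis x"
    using xy by (simp add: m_assoc)
  finally have "?t \<oplus> basis y = basis x" .
  then have diff: "basis x \<ominus> basis y = ?t"
    using xy by (metis add.inv_solve_right' inv_closed m_closed minus_eq)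
  fix u assume "u \<in> orbit x"
  then obtain a where u: "u \<in> X" "a \<in> carrier A" "\<Lambda> a (basis x) = basis u"
    by (auto simp: orbit_def)
  obtain v where v: "v \<in> X" "\<Lambda> a (basis y) = basis v"
    using action_permutes u(2) assms(2) by blast
  have "u \<noteq> v"
    using u v xy assms basis_inj action_inv_cancel(1) by metis
  have "coeff (\<Lambda> a (basis x \<ominus> basis y)) u = 1"
    using u v xy \<open>u \<noteq> v\<close> by (simp add: minus_eq action_add action_neg)
  moreover obtain k where
    "\<And>w. coeff (\<Lambda> a (basis x \<ominus> basis y)) w = k * coeff (basis x \<ominus> basis y) w"
    using socle_action_multiple[OF t u(2)] diff by metis
  ultimately have "coeff (basis x \<ominus> basis y) u \<noteq> 0"
    by (metis mult_zero_right zero_neq_one)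
  then show "u \<in> {x, y}"
    using assms xy by (auto simp: minus_eq split: if_splits)
qed

text \<open>
  Here $x \cdot y = x + \lambda_x(y) = 2x$ acts as $\lambda_x \lambda_y = \lambda_x^2$, which is the
  identity, so $2x$ is in the socle. But $\lambda_x(2x) = 2y$ is not a multiple of $2x$.
\<close>

lemma no_swapping_pair:
  assumes "x \<in> X" "y \<in> X" "x \<noteq> y"
    and swap: "\<Lambda> (basis x) (basis x) = basis y" "\<Lambda> (basis x) (basis y) = basis x"
    and same: "\<And>w. w \<in> X \<Longrightarrow> \<Lambda> (basis x) (basis w) = \<Lambda> (basis y) (basis w)"
    and fixed: "\<And>w. w \<in> X - {x, y} \<Longrightarrow> \<Lambda> (basis x) (basis w) = basis w"
  shows False
proof -
  let ?s = "basis x \<oplus> basis x"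
  have xy: "basis x \<in> carrier A" "basis y \<in> carrier A"
    using assms by auto
  have s: "?s = basis x \<otimes> basis y"
    using xy swap by (simp add: mult_eq_add_action)
  have "\<Lambda> (basis x \<otimes> basis y) (basis w) = basis w" if "w \<in> X" for w
    using that xy same[of w] swap fixed[of w] by (cases "w = x \<or> w = y") (auto simp: action_mult)
  then have "?s \<in> socle"
    using xy s by (intro socleI) auto
  then obtain k where "\<And>w. coeff (\<Lambda> (basis x) ?s) w = k * coeff ?s w"
    using socle_action_multiple xy by metis
  from this[of y] show False
    using xy swap assms(1-3) by (simp add: action_add)
qed

text \<open>
  By \<open>orbit_acts_trivially_outside\<close>, agreement on the orbit extends to agreement on the whole
  basis when \<open>y\<close> is in the orbit of \<open>z\<close>; otherwise \<open>y\<close> acts trivially on that orbit, so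
  \<open>x\<close> acts trivially everywhere and has a trivial orbit.
\<close>

theorem orbit_separates:
  assumes z: "z \<in> X" "orbit z \<noteq> {z}"
    and x: "x \<in> orbit z" and y: "y \<in> X"
    and agree: "\<And>w. w \<in> orbit z \<Longrightarrow> \<Lambda> (basis x) (basis w) = \<Lambda> (basis y) (basis w)"
  shows "x = y"
proof (rule ccontr)
  assume "x \<noteq> y"
  have xX: "x \<in> X" and orbit: "orbit x = orbit z"
    using x orbit_subset orbit_eq[OF z(1)] by blast+
  have not_socle: "basis x \<notin> socle"
    using orbit_of_socle_element[OF xX] orbit orbit_refl[OF z(1)] z(2) by auto
  have outside: "\<Lambda> (basis x) (basis w) = basis w" if "w \<in> X" "w \<notin> orbit z" for w
    using orbit_acts_trivially_outside[OF z(1) x] that by blast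
  show False
  proof (cases "y \<in> orbit z")
    case False
    then have "w \<notin> orbit y" if "w \<in> orbit z" for w
      using that y z(1) orbit_eq orbit_sym orbit_refl by blast
    then have "\<Lambda> (basis y) (basis w) = basis w" if "w \<in> orbit z" for w
      using that orbit_acts_trivially_outside[OF y orbit_refl[OF y]] orbit_subset by blast
    then have "basis x \<in> socle"
      using outside agree basis_closed[OF xX] by (intro socleI) metis+
    then show False using not_socle by simp
  next
    case True
    have same: "\<Lambda> (basis x) (basis w) = \<Lambda> (basis y) (basis w)" if "w \<in> X" for w
      using that agree outside orbit_acts_trivially_outside[OF z(1) True] by (cases "w \<in> orbit z") auto
    have pair: "orbit z = {x, y}"
      using orbit_of_equally_acting[OF xX y \<open>x \<noteq> y\<close> same] orbit x True by auto
    have xy: "basis x \<in> carrier A" "basis y \<in> carrier A"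
      using xX y by auto
    obtain u v where u: "u \<in> {x, y}" "\<Lambda> (basis x) (basis x) = basis u"
      and v: "v \<in> {x, y}" "\<Lambda> (basis x) (basis y) = basis v"
      using orbit_action[OF xy(1) z(1)] pair by (metis insertCI)
    have "u \<noteq> v"
      using u v xy \<open>x \<noteq> y\<close> xX y basis_inj action_inv_cancel(1) by metis
    show False
    proof (cases "u = x")
      case True
      then have "basis x \<in> socle"
        using u v \<open>u \<noteq> v\<close> outside pair xy by (intro socleI) auto
      then show False using not_socle by simp
    next
      case False
      then show False
        using u v \<open>u \<noteq> v\<close> no_swapping_pair[OF xX y \<open>x \<noteq> y\<close> _ _ same] outside pair by auto
    qed
  qed
qed

end

end


section \<open>Subsets that survive all retractions\<close>

text \<open>
  At a successor stage, the classes of \<open>x\<close>, \<open>w\<close> and $\lambda_x(w)$ for $x, w \in Y$ are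
  singletons by induction. If \<open>y\<close> becomes identified with \<open>x\<close>, then $\lambda_y(w)$ is in the class
  of $\lambda_x(w)$ and so equals it; hence \<open>y\<close> acts on \<open>Y\<close> like \<open>x\<close>. Letting \<open>y\<close> range
  over all of \<open>X\<close>, not only over \<open>Y\<close>, is what makes full classes singletons and keeps the
  induction going.
\<close>

lemma ret_series_class_singleton:
  assumes W: "Well_order W" and "\<alpha> \<in> Field W" and X: "Y \<subseteq> X"
    and closed: "\<And>x y. \<lbrakk>x \<in> X; y \<in> X\<rbrakk> \<Longrightarrow> lam r x y \<in> X"
    and stable: "\<And>x y. \<lbrakk>x \<in> Y; y \<in> Y\<rbrakk> \<Longrightarrow> lam r x y \<in> Y"
    and separated: "\<And>x y. \<lbrakk>x \<in> Y; y \<in> X; \<And>w. w \<in> Y \<Longrightarrow> lam r x w = lam r y w\<rbrakk> \<Longrightarrow> x = y"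
    and "x \<in> Y" "(x, y) \<in> ret_series W X r \<alpha>"
  shows "x = y"
proof -
  interpret wo_rel W by (simp add: wo_rel_def W)
  let ?R = "ret_series W X r"
  have "\<alpha> \<in> Field W \<longrightarrow> (\<forall>x\<in>Y. \<forall>y. (x, y) \<in> ?R \<alpha> \<longrightarrow> x = y)"
  proof (induction \<alpha> rule: well_order_inductZSL)
    case Zero
    then show ?case
      by (auto simp: ret_series_zero[OF W])
  next
    case (Suc \<alpha>)
    have \<alpha>: "\<alpha> \<in> Field W"
      using Suc(1) by (auto simp: aboveS_def Field_def)
    have equiv: "equiv X (?R \<alpha>)"
      using ret_series_equiv_mono[OF W \<alpha>] by blast
    have self: "w \<in> ?R \<alpha> `` {w}" if "w \<in> X" for w
      using equiv_class_self[OF equiv that] .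
    have cls: "?R \<alpha> `` {w} = {w}" if "w \<in> Y" for w
      using Suc(2) \<alpha> that X self by blast
    have "x = y" if x: "x \<in> Y" and xy: "(x, y) \<in> ?R (succ \<alpha>)" for x y
    proof (rule separated[OF x])
      have step: "(x, y) \<in> ret_step X r (?R \<alpha>)"
        using xy Suc(1) by (simp add: ret_series_succ[OF W])
      then show y: "y \<in> X"
        by (simp add: ret_step_def)
      fix w assume w: "w \<in> Y"
      then have "?R \<alpha> `` {w} \<in> X // ?R \<alpha>"
        using X by (auto intro: quotientI)
      then have "lam (quot_map (?R \<alpha>) r) (?R \<alpha> `` {x}) (?R \<alpha> `` {w}) =
                 lam (quot_map (?R \<alpha>) r) (?R \<alpha> `` {y}) (?R \<alpha> `` {w})"
        using step by (simp add: ret_step_def ret_equiv_def)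
      \<comment> \<open>The left side involves no other representatives, the right side ranges over all \<open>v\<close> equivalent
        to \<open>y\<close>; only the term for \<open>v = y\<close> matters.\<close>
      then have "?R \<alpha> `` {lam r x w} = (\<Union>v\<in>?R \<alpha> `` {y}. ?R \<alpha> `` {lam r v w})"
        by (simp add: lam_def quot_map_def cls[OF x] cls[OF w])
      moreover have "lam r y w \<in> ?R \<alpha> `` {lam r y w}"
        using self closed y w X by blast
      ultimately have "lam r y w \<in> ?R \<alpha> `` {lam r x w}"
        using self[OF y] by blast
      then show "lam r x w = lam r y w"
        using cls[OF stable[OF x w]] by auto
    qed
    then show ?case by blast
  next
    case (Lim \<alpha>)
    then show ?case
      by (auto simp: ret_series_lim[OF W] underS_def Field_def)
  qed
  then show ?thesis using assms by blast
qed

section \<open>The structure brace of a solution\<close>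

text \<open>
  The maps $\lambda_x$ of the solution are bijections of \<open>X\<close>, so both $x$ and $x^{-1}$ map the basis
  into itself; every element of the structure group is a product of such letters.
\<close>

lemma structure_brace_permutes_basis:
  assumes sol: "ybe_solution X r" and brace: "is_structure_brace X r A"
  obtains h where "permuted_basis_brace A X h"
    "\<And>x. x \<in> X \<Longrightarrow> h (frag_of x) = structure_map X r x"
proof -
  let ?c = "\<lambda>w. word_cong X (structure_relations X r) `` {w}" and ?\<iota> = "structure_map X r"
  interpret left_brace A
    using brace by (simp add: is_structure_brace_def)
  obtain h where h: "h \<in> iso (free_Abelian_group X) (add_monoid A)"
    "\<And>x. x \<in> X \<Longrightarrow> h (frag_of x) = ?\<iota> x"
    using brace by (auto simp: is_structure_brace_def)
  have carrier: "carrier A = words X // word_cong X (structure_relations X r)"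
    using brace by (simp add: is_structure_brace_def structure_group_def presented_group_def)
  have cls: "?c w \<in> carrier A" if "w \<in> words X" for w
    using that by (auto simp: carrier intro: quotientI)
  have mult: "?c u \<otimes>\<^bsub>A\<^esub> ?c v = ?c (u @ v)" if "u \<in> words X" "v \<in> words X" for u v
    using brace that cls
    by (simp add: is_structure_brace_def structure_group_def presented_group_mult)
  have Nil: "[] \<in> words X"
    by (simp add: words_def)
  have one: "?c [] = \<one>\<^bsub>A\<^esub>"
    using mult[OF Nil Nil] cls[OF Nil] by simp
  have letter: "[(b, x)] \<in> words X" if "x \<in> X" for b x
    using that by (simp add: words_def)
  have inverse: "?c [(False, x)] = inv\<^bsub>A\<^esub> ?\<iota> x" if "x \<in> X" for x
  proof -
    have "([(False, x), (True, x)], []) \<in> word_cong X (structure_relations X r)"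
      using word_cong.cancel[OF Nil Nil that, of False] by simp
    then have "?c [(False, x), (True, x)] = ?c []"
      by (rule equiv_class_eq[OF word_cong_equiv])
    then have "?c [(False, x)] \<otimes>\<^bsub>A\<^esub> ?\<iota> x = \<one>\<^bsub>A\<^esub>"
      using mult[OF letter letter, OF that that] one by (simp add: structure_map_def)
    then show ?thesis
      using cls[OF letter[OF that]] by (simp add: structure_map_def inv_equality)
  qed
  have \<iota>: "?\<iota> x \<in> carrier A" if "x \<in> X" for x
    using cls[OF letter[OF that]] by (simp add: structure_map_def)
  have lam: "brace_lambda A (?\<iota> x) (?\<iota> y) = ?\<iota> (lam r x y)" if "x \<in> X" "y \<in> X" for x y
    using brace that by (simp add: is_structure_brace_def)
  have bij: "bij_betw (lam r x) X X" if "x \<in> X" for x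
    using sol that by (simp add: ybe_solution_def)
  have letter_permutes: "\<exists>z\<in>X. brace_lambda A (?c [(b, x)]) (?\<iota> y) = ?\<iota> z"
    if x: "x \<in> X" and y: "y \<in> X" for b x y
  proof (cases b)
    case True
    then show ?thesis
      using lam[OF x y] bij_betwE[OF bij[OF x]] y by (auto simp: structure_map_def)
  next
    case False
    obtain z where "z \<in> X" "y = lam r x z"
      using bij[OF x] y by (auto simp: bij_betw_def)
    then have "brace_lambda A (inv\<^bsub>A\<^esub> ?\<iota> x) (?\<iota> y) = ?\<iota> z"
      using lam[of x z] action_inv_cancel(1)[of "?\<iota> x" "?\<iota> z"] \<iota> x by simp
    then show ?thesis
      using False inverse[OF x] \<open>z \<in> X\<close> by auto
  qed
  have "\<forall>y\<in>X. \<exists>z\<in>X. brace_lambda A (?c w) (?\<iota> y) = ?\<iota> z" if "w \<in> words X" for w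
    using that
  proof (induction w)
    case Nil
    then show ?case using \<iota> by (auto simp: one)
  next
    case (Cons l w)
    obtain b x where l: "l = (b, x)" "x \<in> X" and w: "w \<in> words X"
      using Cons.prems by (cases l) (auto simp: words_def)
    have "?c (l # w) = ?c [(b, x)] \<otimes>\<^bsub>A\<^esub> ?c w"
      using mult[OF letter w] l by simp
    then have "brace_lambda A (?c (l # w)) (?\<iota> y) =
        brace_lambda A (?c [(b, x)]) (brace_lambda A (?c w) (?\<iota> y))" if "y \<in> X" for y
      using action_mult[OF cls cls \<iota>, OF letter w] l that by simp
    then show ?case
      using Cons.IH[OF w] letter_permutes[OF l(2)] by metis
  qed
  then have "\<exists>z\<in>X. brace_lambda A a (h (frag_of y)) = h (frag_of z)"
    if "a \<in> carrier A" "y \<in> X" for a y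
    using that h(2) unfolding carrier by (auto elim!: quotientE)
  then have "permuted_basis_brace A X h"
    using left_brace_axioms h(1)
    by (simp add: permuted_basis_brace_def permuted_basis_brace_axioms_def)
  then show thesis using that h(2) by blast
qed

text \<open>
  A nontrivial orbit would survive at the stage \<open>\<alpha>\<close>, where everything is identified. So all orbits
  are trivial, which means $\lambda_x(y) = y$; involutivity then determines $\rho$.
\<close>

lemma twist_of_total_retraction:
  assumes sol: "ybe_solution X r" and brace: "is_structure_brace X r A"
    and dedekind: "dedekind_brace A"
    and W: "Well_order W" "\<alpha> \<in> Field W" "card (X // ret_series W X r \<alpha>) = 1"
  shows "twist_solution X r"
proof -
  obtain h where "permuted_basis_brace A X h"
    and basis: "\<And>x. x \<in> X \<Longrightarrow> h (frag_of x) = structure_map X r x"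
    using structure_brace_permutes_basis[OF sol brace] by blast
  then interpret permuted_basis_brace A X h by simp
  let ?E = "ret_series W X r \<alpha>"
  have equiv: "equiv X ?E"
    using ret_series_equiv_mono[OF W(1,2)] by blast
  have total: "(x, y) \<in> ?E" if "x \<in> X" "y \<in> X" for x y
  proof -
    have "?E `` {x} = ?E `` {y}"
      using W(3) that by (metis card_1_singletonE quotientI singletonD)
    then show ?thesis using equiv that by (simp add: eq_equiv_class_iff)
  qed
  have closed: "lam r x y \<in> X" if "x \<in> X" "y \<in> X" for x y
    using sol that bij_betwE by (fastforce simp: ybe_solution_def)
  have lam: "brace_lambda A (basis x) (basis y) = basis (lam r x y)" if "x \<in> X" "y \<in> X" for x y
    using brace that closed basis by (simp add: is_structure_brace_def)
  have orbit_lam: "lam r x y \<in> orbit z" if x: "x \<in> X" and z: "z \<in> X" and y: "y \<in> orbit z" for x y z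
  proof -
    obtain w where w: "w \<in> orbit z" "brace_lambda A (basis x) (basis y) = basis w"
      using orbit_action[OF basis_closed[OF x] z y] .
    have "y \<in> X" "w \<in> X"
      using y w(1) orbit_subset by blast+
    then have "basis w = basis (lam r x y)" "lam r x y \<in> X"
      using w(2) lam[OF x] closed[OF x] by simp_all
    then have "w = lam r x y"
      using basis_inj[OF \<open>w \<in> X\<close>] by blast
    then show ?thesis using w(1) by simp
  qed
  have singleton: "orbit z = {z}" if z: "z \<in> X" for z
  proof (rule ccontr)
    assume nontrivial: "orbit z \<noteq> {z}"
    then obtain u where u: "u \<in> orbit z" "u \<noteq> z"
      using orbit_refl[OF z] by blast
    have "z = u"
    proof (rule ret_series_class_singleton[OF W(1,2) orbit_subset closed])
      show "lam r x y \<in> orbit z" if "x \<in> orbit z" "y \<in> orbit z" for x y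
        using orbit_lam z that orbit_subset by blast
      show "x = y" if "x \<in> orbit z" "y \<in> X" "\<And>w. w \<in> orbit z \<Longrightarrow> lam r x w = lam r y w" for x y
        using that lam orbit_subset
        by (intro orbit_separates[OF dedekind z nontrivial]) (auto simp: subset_iff)
      show "(z, u) \<in> ?E"
        using total z u orbit_subset by blast
    qed (simp_all add: orbit_refl z)
    then show False using u by simp
  qed
  have lam_trivial: "lam r x y = y" if "x \<in> X" "y \<in> X" for x y
    using orbit_lam[OF that(1,2) orbit_refl[OF that(2)]] singleton[OF that(2)] by simp
  show ?thesis
    unfolding twist_solution_def
  proof (intro ballI)
    fix x y assume x: "x \<in> X" and y: "y \<in> X"
    define v where "v = snd (r (x, y))"
    have v: "r (x, y) = (y, v)"
      using lam_trivial[OF x y] by (simp add: lam_def v_def prod_eq_iff)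
    have "r (x, y) \<in> X \<times> X"
      using sol x y by (auto simp: ybe_solution_def Pi_iff)
    then have "v \<in> X"
      using v by simp
    moreover have "r (r (x, y)) = (x, y)"
      using sol x y by (simp add: ybe_solution_def)
    then have "r (y, v) = (x, y)"
      using v by simp
    ultimately have "v = x"
      using lam_trivial[OF y, of v] by (simp add: lam_def)
    then show "r (x, y) = (y, x)" using v by simp
  qed
qed

theorem corollary6:
  fixes X :: "'a set"
    and r :: "'a \<times> 'a \<Rightarrow> 'a \<times> 'a"
    and A :: "(bool \<times> 'a) list set ring"
  assumes "ybe_solution X r"
    and "is_structure_brace X r A"
  shows "(hypermultipermutational X r \<and> dedekind_brace A \<and> \<not> periodic_group (add_monoid A)
            \<longrightarrow> twist_solution X r) \<and>
         (finite X \<and> multipermutational X r \<and> dedekind_brace A \<longrightarrow> twist_solution X r)"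
proof (intro conjI impI)
  assume "hypermultipermutational X r \<and> dedekind_brace A \<and> \<not> periodic_group (add_monoid A)"
  then have A: "dedekind_brace A"
    and card: "card (X // ret_infinity X r) = 1"
    by (simp_all add: hypermultipermutational_def)
  let ?W = "ret_ordinals X" and ?S = "{\<alpha>. ret_stable X r \<alpha>}"
  interpret wo_rel ?W
    by (simp add: wo_rel_def ret_ordinals_Well_order)
  have "?S \<subseteq> Field ?W" "?S \<noteq> {}"
    using ret_series_stabilises by (auto simp: ret_stable_def)
  then have "minim ?S \<in> Field ?W"
    using minim_in by blast
  then show "twist_solution X r"
    using twist_of_total_retraction[OF assms A ret_ordinals_Well_order] card
    by (simp add: ret_infinity_def)
next
  assume "finite X \<and> multipermutational X r \<and> dedekind_brace A"
  then obtain m where "dedekind_brace A" "card (X // ret_series natLeq X r m) = 1"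
    by (auto simp: multipermutational_def multipermutational_of_level_def)
  then show "twist_solution X r"
    using twist_of_total_retraction[OF assms _ natLeq_Well_order] by (simp add: Field_natLeq)
qed

end
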